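(* Let $f_h^n\in V_h^k(\mathcal{E})$, $\Delta t>0$, and let $f_h^*=\mathcal{S}^h_{\mathbf{f}}(\Delta t)f_h^n$, where $\mathcal{S}^h_{\mathbf{f}}$ is the conservative semi-Lagrangian discontinuous Galerkin operator for $\partial_tf+v\,\partial_xf=0$ defined in the context. Then, under the assumption of periodic boundary conditions, $$\|f_h^*\|\le\|f_h^n\| .$$
   Context: $\Omega_x=[x_L,x_R]$ and $\Omega_v=[v_{\min},v_{\max}]$ are partitioned uniformly into cells $I_{x_j}=[x_{j-1/2},x_{j+1/2}]$, $j=1,\dots,N_x$, and $I_{v_i}$, $i=1,\dots,N_v$. Functions are extended periodically in $x$. For an integer $k\ge0$, $\mathcal{D}_k(\mathcal{E}_x)$ (resp. $\mathcal{D}_k(\mathcal{E}_v)$) is the space of functions whose restriction to each $I_{x_j}$ (resp. $I_{v_i}$) is a polynomial of degree at most $k$, and $V_h^k(\mathcal{E})=\mathcal{D}_k(\mathcal{E}_x)\otimes\mathcal{D}_k(\mathcal{E}_v)$. Let $\{v_{i,p}\}_{p=1}^{k+1}$ be the $k+1$ Gauss(-Legendre) quadrature points of $I_{v_i}$; an element of $V_h^k(\mathcal{E})$ is determined by its restrictions to the lines $v=v_{i,p}$ (all $i,p$). The operator $\mathcal{S}^h_{\mathbf{f}}(\Delta t)$ maps $f_h^n\in V_h^k(\mathcal{E})$ to the $f_h^*\in V_h^k(\mathcal{E})$ such that for every $i,p$ and $j$ and every $\Psi\in\mathcal{D}_k(\mathcal{E}_x)$, $$\int_{I_{x_j}} f_h^*(x,v_{i,p})\Psi(x)\,\mathrm{d}x=\int_{I_{x_j}^*}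 f_h^n(x,v_{i,p})\,\psi^n(x)\,\mathrm{d}x,$$ where $I_{x_j}^*=[x_{j-1/2}-v_{i,p}\Delta t,\;x_{j+1/2}-v_{i,p}\Delta t]$ and $\psi^n(x)=\Psi|_{I_{x_j}}(x+v_{i,p}\Delta t)$ for $x\in I_{x_j}^*$ (the test function transported along characteristics). The norm is $\|f\|=\left(\int_{\Omega_x}\int_{\Omega_v}|f(x,v)|^2\,\mathrm{d}v\,\mathrm{d}x\right)^{1/2}$. *)

theory Defs
  imports "HOL-Analysis.Analysis" "HOL-Computational_Algebra.Polynomial"
begin

text \<open>
  A uniform partition of the interval from \<open>mesh_lo\<close> to \<open>mesh_hi\<close> into \<open>mesh_n\<close> cells.
  Cells are numbered from 1; \<open>edge M j\<close> is the point written $x_{j+1/2}$ (so \<open>edge M 0\<close> is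
  $x_{1/2}$, the left end of the domain).
\<close>

record mesh =
  mesh_lo :: real
  mesh_hi :: real
  mesh_n :: nat

definition valid_mesh :: "mesh \<Rightarrow> bool" where
  "valid_mesh M \<longleftrightarrow> mesh_lo M < mesh_hi M \<and> 1 \<le> mesh_n M"

definition mesh_dom :: "mesh \<Rightarrow> real set" where
  "mesh_dom M = {mesh_lo M..mesh_hi M}"

definition edge :: "mesh \<Rightarrow> nat \<Rightarrow> real" where
  "edge M j = mesh_lo M + real j * ((mesh_hi M - mesh_lo M) / real (mesh_n M))"

definition cell :: "mesh \<Rightarrow> nat \<Rightarrow> real set" where
  "cell M j = {edge M (j - 1)..edge M j}"

text \<open>
  Piecewise polynomials are discontinuous across cell edges, where they are two-valued.  Here they
  are represented by total functions that are polynomial on the interior of every cell; the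
  value at an edge is arbitrary, and so is the value outside the domain.
  (Asking for a polynomial on the closed cells would force continuity.)
\<close>

definition dg_space :: "mesh \<Rightarrow> nat \<Rightarrow> (real \<Rightarrow> real) set" where
  "dg_space M k = {g. \<forall>j\<in>{1..mesh_n M}. \<exists>q :: real poly.
      degree q \<le> k \<and> (\<forall>x\<in>interior (cell M j). g x = poly q x)}"

text \<open>The tensor product: finite sums of products, as functions on the phase-space domain.\<close>

definition dg_space2 :: "mesh \<Rightarrow> mesh \<Rightarrow> nat \<Rightarrow> (real \<Rightarrow> real \<Rightarrow> real) set" where
  "dg_space2 X V k = {f. \<exists>(r::nat) g h.
      (\<forall>m<r. g m \<in> dg_space X k \<and> h m \<in> dg_space V k) \<and>
      (\<forall>x\<in>mesh_dom X. \<forall>v\<in>mesh_dom V. f x v = (\<Sum>m<r. g m x * h m v))}"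

text \<open>Legendre polynomials by Rodrigues' formula.\<close>

definition legendre_poly :: "nat \<Rightarrow> real poly" where
  "legendre_poly n = smult (1 / (2 ^ n * fact n)) ((pderiv ^^ n) ([:-1, 0, 1:] ^ n))"

text \<open>
  The \<open>n\<close> Gauss-Legendre points on \<open>[-1, 1]\<close> are the roots of the Legendre polynomial of
  degree \<open>n\<close>; \<open>gauss_point n p\<close> for \<open>p = 1, \<dots>, n\<close> lists them in increasing order.
  \<open>gauss_node M k i p\<close> is the \<open>p\<close>-th of the \<open>k + 1\<close> points carried over to the \<open>i\<close>-th cell.
\<close>

definition gauss_point :: "nat \<Rightarrow> nat \<Rightarrow> real" where
  "gauss_point n p = sorted_list_of_set {x. poly (legendre_poly n) x = 0} ! (p - 1)"

definition gauss_node :: "mesh \<Rightarrow> nat \<Rightarrow> nat \<Rightarrow> nat \<Rightarrow> real" where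
  "gauss_node M k i p =
     (edge M (i - 1) + edge M i) / 2 + (edge M i - edge M (i - 1)) / 2 * gauss_point (k + 1) p"

text \<open>Periodic extension of the values on the half-open interval from \<open>mesh_lo\<close> to \<open>mesh_hi\<close>.\<close>

definition periodic_ext :: "mesh \<Rightarrow> (real \<Rightarrow> real) \<Rightarrow> real \<Rightarrow> real" where
  "periodic_ext M g x =
     (let L = mesh_hi M - mesh_lo M in g (x - L * of_int \<lfloor>(x - mesh_lo M) / L\<rfloor>))"

text \<open>
  \<open>sldg_step X V k dt f f'\<close> says that \<open>f'\<close> is the image of \<open>f\<close> under the semi-Lagrangian DG operator
  with time step \<open>dt\<close>.  It is a relation because \<open>f'\<close> is determined only up to its (irrelevant)
  values at cell edges and outside the domain.  For \<open>x\<close> in the shifted cell, \<open>x + w * dt\<close> lies in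
  cell \<open>j\<close>, so the transported test function only sees the restriction of \<open>\<Psi>\<close> to that cell.
\<close>

definition sldg_step ::
  "mesh \<Rightarrow> mesh \<Rightarrow> nat \<Rightarrow> real \<Rightarrow> (real \<Rightarrow> real \<Rightarrow> real) \<Rightarrow> (real \<Rightarrow> real \<Rightarrow> real) \<Rightarrow> bool" where
  "sldg_step X V k dt f f' \<longleftrightarrow>
     f' \<in> dg_space2 X V k \<and>
     (\<forall>i\<in>{1..mesh_n V}. \<forall>p\<in>{1..k+1}. \<forall>j\<in>{1..mesh_n X}. \<forall>\<Psi>\<in>dg_space X k.
        let w = gauss_node V k i p in
        integral (cell X j) (\<lambda>x. f' x w * \<Psi> x) =
        integral {edge X (j - 1) - w * dt..edge X j - w * dt}
          (\<lambda>x. periodic_ext X (\<lambda>y. f y w) x * \<Psi> (x + w * dt)))"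

definition l2_norm :: "mesh \<Rightarrow> mesh \<Rightarrow> (real \<Rightarrow> real \<Rightarrow> real) \<Rightarrow> real" where
  "l2_norm X V f =
     sqrt (integral (mesh_dom X) (\<lambda>x. integral (mesh_dom V) (\<lambda>v. \<bar>f x v\<bar>\<^sup>2)))"

end

theory Submission
  imports Defs
begin

text \<open>
  Both norms are computed line by line: for fixed \<open>x\<close> the square of an element of the discrete space
  has degree at most \<open>2 * k\<close> in \<open>v\<close> on every cell, so Gauss quadrature with \<open>k + 1\<close> points is exact and the
  squared norm is a combination, with nonnegative weights, of the squared norms of the restrictions
  to the lines \<open>v = gauss_node V k i p\<close>.  On such a line the scheme is a translation followed
  by an orthogonal projection: testing with \<open>f'\<close> itself and using \<open>2 a b \<le> a\<^sup>2 + b\<^sup>2\<close> bounds the square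
  integral of \<open>f'\<close> over a cell by that of \<open>f\<close> over the shifted cell, and by periodicity the shifted cells
  add up to the whole domain.
\<close>

section \<open>Integrals\<close>

lemma integrable_poly: "poly (p :: real poly) integrable_on {a..b}"
  by (intro integrable_continuous_interval continuous_intros)

text \<open>Pointwise this is 2ab \<le> a^2 + b^2. Integrability of the product is not assumed: a
  non-integrable product has integral 0 by convention, and the right-hand side is
  nonnegative.\<close>

lemma integral_mult_le_half_sum_squares:
  fixes u v :: "real \<Rightarrow> real"
  assumes u: "(\<lambda>x. (u x)\<^sup>2) integrable_on S" and v: "(\<lambda>x. (v x)\<^sup>2) integrable_on S"
  shows "integral S (\<lambda>x. u x * v x)
    \<le> (integral S (\<lambda>x. (u x)\<^sup>2) + integral S (\<lambda>x. (v x)\<^sup>2)) / 2"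
proof -
  have *: "integral S (\<lambda>x. ((u x)\<^sup>2 + (v x)\<^sup>2) / 2)
      = (integral S (\<lambda>x. (u x)\<^sup>2) + integral S (\<lambda>x. (v x)\<^sup>2)) / 2"
    using integral_add[OF u v] by simp
  have int: "(\<lambda>x. ((u x)\<^sup>2 + (v x)\<^sup>2) / 2) integrable_on S"
    using integrable_add[OF u v] by (rule integrable_on_divide)
  show ?thesis
  proof (cases "(\<lambda>x. u x * v x) integrable_on S")
    case True
    have "integral S (\<lambda>x. u x * v x) \<le> integral S (\<lambda>x. ((u x)\<^sup>2 + (v x)\<^sup>2) / 2)"
      using True int
    proof (rule integral_le)
      show "u x * v x \<le> ((u x)\<^sup>2 + (v x)\<^sup>2) / 2" for x
        using sum_squares_bound[of "u x" "v x"] by simp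
    qed
    then show ?thesis using * by simp
  next
    case False
    then show ?thesis
      using integral_nonneg[OF u] integral_nonneg[OF v] by (simp add: not_integrable_integral)
  qed
qed

lemma has_integral_partition:
  fixes \<phi> :: "real \<Rightarrow> real" and e :: "nat \<Rightarrow> real"
  assumes "mono e" and "\<And>j. j \<in> {1..n} \<Longrightarrow> (\<phi> has_integral I j) {e (j - 1)..e j}"
  shows "(\<phi> has_integral (\<Sum>j=1..n. I j)) {e 0..e n}"
  using assms(2)
proof (induction n)
  case 0
  then show ?case by (simp add: has_integral_refl)
next
  case (Suc n)
  have "(\<phi> has_integral (\<Sum>j=1..n. I j)) {e 0..e n}"
    using Suc by simp
  moreover have "(\<phi> has_integral I (Suc n)) {e n..e (Suc n)}"
    using Suc.prems[of "Suc n"] by simp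
  moreover have "e 0 \<le> e n" "e n \<le> e (Suc n)"
    using assms(1) by (simp_all add: mono_def)
  ultimately show ?case
    using has_integral_combine by (simp, blast)
qed

lemma has_integral_translate:
  fixes \<phi> :: "real \<Rightarrow> real"
  assumes "(\<phi> has_integral I) {a..b}"
  shows "((\<lambda>x. \<phi> (x + s)) has_integral I) {a - s..b - s}"
proof (cases "a \<le> b")
  case True
  then show ?thesis
    using has_integral_affinity[of \<phi> I a b 1 s] assms by simp
next
  case False
  then show ?thesis using assms by simp
qed

text \<open>On a window of one period the extension consists of two translated pieces of \<open>\<phi>\<close>, split at
  the only multiple of the period (counted from \<open>mesh_lo M\<close>) in the half-open window.\<close>
lemma has_integral_periodic_ext:
  assumes M: "valid_mesh M" and \<phi>: "\<phi> integrable_on mesh_dom M"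
  shows "(periodic_ext M \<phi> has_integral integral (mesh_dom M) \<phi>)
    {mesh_lo M - s..mesh_hi M - s}"
proof -
  define lo L where "lo = mesh_lo M" and "L = mesh_hi M - mesh_lo M"
  have L: "L > 0" using M by (simp add: L_def valid_mesh_def)
  have dom: "mesh_dom M = {lo..lo + L}" by (simp add: mesh_dom_def lo_def L_def)
  \<comment> \<open>The window begins at \<open>lo - s\<close>, which is offset \<open>r\<close> in
    [0, L) inside period number \<open>m\<close>: \<open>lo - s = lo + r + L * m\<close>.\<close>
  define m :: int where "m = \<lfloor>- s / L\<rfloor>"
  define r where "r = - s - L * m"
  have "of_int m \<le> - s / L" "- s / L < of_int m + 1"
    unfolding m_def by linarith+
  then have "of_int m * L \<le> - s" "- s < (of_int m + 1) * L"
    using L by (simp_all only: pos_le_divide_eq pos_divide_less_eq)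
  then have r: "0 \<le> r" "r < L"
    by (simp_all add: r_def algebra_simps)
  have s: "s = - r - L * m" by (simp add: r_def)
  have ext: "periodic_ext M \<phi> x = \<phi> (x - L * of_int i)"
    if "lo + L * of_int i \<le> x" "x < lo + L * of_int i + L" for x i
  proof -
    have "\<lfloor>(x - lo) / L\<rfloor> = i"
      using that L by (intro floor_unique) (simp_all add: field_simps)
    then show ?thesis by (simp add: periodic_ext_def Let_def lo_def L_def)
  qed
  have piece: "(periodic_ext M \<phi> has_integral integral {a..b} \<phi>) {a + L * of_int i..b + L * of_int i}"
    if "lo \<le> a" "b \<le> lo + L" for a b i
  proof -
    have "\<phi> integrable_on {a..b}"
      using \<phi> that by (intro integrable_on_subinterval[OF \<phi>]) (auto simp: dom)
    then have "(\<phi> has_integral integral {a..b} \<phi>) {a..b}"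
      by (rule integrable_integral)
    from has_integral_translate[OF this, of "- L * of_int i"]
    have "((\<lambda>x. \<phi> (x - L * of_int i)) has_integral integral {a..b} \<phi>)
        {a + L * of_int i..b + L * of_int i}" by simp
    \<comment> \<open>The right end is exempted because for \<open>b = lo + L\<close> the extension
      returns the value of \<phi> at \<open>lo\<close>, not at \<open>lo + L\<close>; a single point
      does not change the integral.\<close>
    then show ?thesis
      by (rule has_integral_spike_finite[of "{b + L * of_int i}", rotated 2])
        (use that in \<open>auto intro!: ext\<close>)
  qed
  have "(periodic_ext M \<phi> has_integral integral {lo + r..lo + L} \<phi> + integral {lo..lo + r} \<phi>)
      {lo + r + L * of_int m..lo + r + L * of_int (m + 1)}"
  proof (rule has_integral_combine)
    show "lo + r + L * of_int m \<le> lo + L * of_int (m + 1)"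
      "lo + L * of_int (m + 1) \<le> lo + r + L * of_int (m + 1)"
      using r by (simp_all add: algebra_simps)
    show "(periodic_ext M \<phi> has_integral integral {lo + r..lo + L} \<phi>)
        {lo + r + L * of_int m..lo + L * of_int (m + 1)}"
      using piece[of "lo + r" "lo + L" m] r by (simp add: algebra_simps)
    show "(periodic_ext M \<phi> has_integral integral {lo..lo + r} \<phi>)
        {lo + L * of_int (m + 1)..lo + r + L * of_int (m + 1)}"
      using piece[of lo "lo + r" "m + 1"] r by simp
  qed
  moreover have "integral {lo + r..lo + L} \<phi> + integral {lo..lo + r} \<phi> = integral {lo..lo + L} \<phi>"
    using Henstock_Kurzweil_Integration.integral_combine[where a = lo and c = "lo + r" and b = "lo + L" and f = \<phi>] r \<phi> by (simp add: dom)
  moreover have "lo + r + L * of_int m = mesh_lo M - s"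
    "lo + r + L * of_int (m + 1) = mesh_hi M - s"
    by (simp_all add: s lo_def L_def algebra_simps)
  ultimately show ?thesis by (simp add: dom)
qed

section \<open>Legendre polynomials and Gauss quadrature\<close>

lemma power_dvd_pderiv:
  fixes p q :: "real poly"
  assumes "p ^ Suc m dvd q"
  shows "p ^ m dvd pderiv q"
proof -
  obtain r where "q = p ^ Suc m * r" using assms by (elim dvdE)
  then have "pderiv q = p ^ m * (p * pderiv r + smult (of_nat (Suc m)) (pderiv p) * r)"
    by (simp only: pderiv_mult pderiv_power_Suc) (simp add: algebra_simps)
  then show ?thesis by simp
qed

lemma power_dvd_funpow_pderiv:
  fixes p q :: "real poly"
  assumes "p ^ (m + j) dvd q"
  shows "p ^ m dvd (pderiv ^^ j) q"
  using assms
proof (induction j arbitrary: m)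
  case (Suc j)
  then have "p ^ Suc m dvd (pderiv ^^ j) q" by (metis add_Suc_shift)
  then show ?case by (simp add: power_dvd_pderiv)
qed simp

text \<open>Each differentiation costs at most one factor of the power, so after
  \<open>j < n\<close> of them a factor x^2 - 1 survives. This kills the boundary terms in the
  orthogonality proof and supplies the endpoints for Rolle's theorem.\<close>

lemma poly_funpow_pderiv_rodrigues:
  assumes "j < n" "x = -1 \<or> x = (1 :: real)"
  shows "poly ((pderiv ^^ j) ([:-1, 0, 1:] ^ n)) x = 0"
proof -
  have "[:-1, 0, 1 :: real:] ^ (1 + j) dvd [:-1, 0, 1:] ^ n"
    using assms by (intro le_imp_power_dvd) simp
  then have "[:-1, 0, 1:] ^ 1 dvd (pderiv ^^ j) ([:-1, 0, 1 :: real:] ^ n)"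
    by (rule power_dvd_funpow_pderiv)
  then show ?thesis using assms(2) by (auto elim!: dvdE)
qed

lemma integral_pderiv_mult:
  fixes p q :: "real poly"
  assumes "a \<le> b"
  shows "integral {a..b} (poly (pderiv p * q))
    = poly (p * q) b - poly (p * q) a - integral {a..b} (poly (p * pderiv q))"
proof -
  have "(poly (pderiv (p * q)) has_integral poly (p * q) b - poly (p * q) a) {a..b}"
    by (intro fundamental_theorem_of_calculus assms)
      (metis DERIV_subset has_real_derivative_iff_has_vector_derivative poly_DERIV top_greatest)
  then have "integral {a..b} (\<lambda>x. poly (pderiv p * q) x + poly (p * pderiv q) x)
      = poly (p * q) b - poly (p * q) a"
    by (simp add: pderiv_mult has_integral_iff poly_add[abs_def] algebra_simps)
  then show ?thesis
    by (simp only: integral_add[OF integrable_poly integrable_poly])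
qed

text \<open>Repeated integration by parts moves the derivatives onto \<open>q\<close>, whose degree
  is too small to survive them; the boundary terms vanish because fewer than \<open>n\<close>
  derivatives remain on the power. Allowing every \<open>j \<le> n\<close> gives an induction that
  spends one derivative and one degree per step.\<close>

lemma integral_rodrigues_orthogonal:
  fixes q :: "real poly"
  assumes "j \<le> n" "degree q < j"
  shows "integral {-1..1} (poly ((pderiv ^^ j) ([:-1, 0, 1:] ^ n) * q)) = 0"
  using assms
proof (induction j arbitrary: q)
  case (Suc j)
  define R :: "real poly" where "R = (pderiv ^^ j) ([:-1, 0, 1:] ^ n)"
  have "poly R 1 = 0" "poly R (-1) = 0"
    using Suc.prems by (simp_all add: R_def poly_funpow_pderiv_rodrigues)
  then have "integral {-1..1} (poly (pderiv R * q)) = - integral {-1..1} (poly (R * pderiv q))"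
    by (simp only: integral_pderiv_mult) (simp del: mult_pCons_left mult_pCons_right)
  \<comment> \<open>A constant \<open>q\<close> is treated apart: its derivative has degree 0, which
    is not below \<open>j\<close> when \<open>j = 0\<close>, so the induction hypothesis might not
    apply.\<close>
  also have "integral {-1..1} (poly (R * pderiv q)) = 0"
  proof (cases "degree q = 0")
    case True
    then have "pderiv q = 0" by (simp add: pderiv_eq_0_iff)
    then show ?thesis by (simp add: poly_0[abs_def])
  next
    case False
    then have "degree (pderiv q) < j"
      using Suc.prems by (simp add: degree_pderiv)
    then show ?thesis
      unfolding R_def using Suc.prems by (intro Suc.IH) simp_all
  qed
  finally show ?case by (simp add: R_def)
qed simp

lemma integral_legendre_mult:
  assumes "degree q < n"
  shows "integral {-1..1} (poly (legendre_poly n * q)) = 0"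
  using integral_rodrigues_orthogonal[OF order_refl assms]
  by (simp add: legendre_poly_def poly_smult[abs_def] del: poly_mult)

section \<open>Number and location of the roots of Legendre polynomials\<close>

lemma degree_funpow_pderiv: "degree ((pderiv ^^ j) (p :: real poly)) = degree p - j"
  by (induction j) (simp_all add: degree_pderiv)

lemma degree_legendre_poly: "degree (legendre_poly n) = n"
  by (simp add: legendre_poly_def degree_funpow_pderiv degree_power_eq)

lemma legendre_poly_nonzero: "legendre_poly n \<noteq> 0"
proof (cases "n = 0")
  case True
  then show ?thesis by (simp add: legendre_poly_def)
next
  case False
  then show ?thesis using degree_legendre_poly[of n] by force
qed

text \<open>Induction by removing the largest zero. The strict bounds by \<open>Min Z\<close> and
  \<open>Max Z\<close> belong to the claim because they keep the critical points found so far to the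
  left of the next one.\<close>

lemma rolle_finite_set:
  fixes p :: "real poly"
  assumes "finite Z" "card Z = Suc m" "\<And>z. z \<in> Z \<Longrightarrow> poly p z = 0"
  shows "\<exists>Y. finite Y \<and> card Y = m \<and> (\<forall>y\<in>Y. Min Z < y \<and> y < Max Z \<and> poly (pderiv p) y = 0)"
  using assms
proof (induction m arbitrary: Z)
  case 0
  then show ?case by (intro exI[of _ "{}"]) simp
next
  case (Suc m)
  define b Z' where "b = Max Z" and "Z' = Z - {b}"
  have "Z \<noteq> {}" using Suc.prems by auto
  then have b: "b \<in> Z" using Suc.prems by (simp add: b_def)
  then have Z': "finite Z'" "card Z' = Suc m" "Z' \<noteq> {}" "Z' \<subseteq> Z"
    using Suc.prems b card_Diff_singleton[OF b] by (auto simp: Z'_def simp flip: card_gt_0_iff dest: card_mono[of "{b}", rotated])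
  obtain Y where Y: "finite Y" "card Y = m"
      "\<And>y. y \<in> Y \<Longrightarrow> Min Z' < y \<and> y < Max Z' \<and> poly (pderiv p) y = 0"
    using Suc.IH[OF Z'(1,2)] Suc.prems(3) Z'(4) by blast
  have "Max Z' \<in> Z'" using Z' by simp
  then have max: "Max Z' \<in> Z" "Max Z' < b"
    using Suc.prems(1) by (auto simp: Z'_def b_def order_less_le)
  \<comment> \<open>Rolle between the two largest zeros \<open>Max Z'\<close> and \<open>b\<close>;
    since all of \<open>Y\<close> lies below \<open>Max Z'\<close>, the point \<open>c\<close> is
    new.\<close>
  obtain c where c: "Max Z' < c" "c < b" "poly (pderiv p) c = 0"
    using poly_MVT[OF max(2), of p] Suc.prems(3) b max by auto
  have "Min Z \<le> Min Z'" using Z' Suc.prems by (intro Min_antimono)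
  moreover have "Min Z' \<le> Max Z'" using Z' by simp
  ultimately show ?case
    using Y c max by (intro exI[of _ "insert c Y"]) (fastforce simp: b_def card_insert_if)
qed

text \<open>As long as \<open>j < n\<close>, the endpoints -1 and 1 are zeros of the
  \<open>j\<close>-th derivative too; with the \<open>j\<close> interior ones this makes
  \<open>j + 2\<close> zeros, and Rolle yields \<open>j + 1\<close> interior zeros of the next
  derivative.\<close>

lemma funpow_pderiv_rodrigues_roots:
  assumes "j \<le> n"
  shows "\<exists>Z. finite Z \<and> card Z = j \<and>
    (\<forall>z\<in>Z. -1 < z \<and> z < 1 \<and> poly ((pderiv ^^ j) ([:-1, 0, 1 :: real:] ^ n)) z = 0)"
  using assms
proof (induction j)
  case 0
  then show ?case by (intro exI[of _ "{}"]) simp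
next
  case (Suc j)
  define R :: "real poly" where "R = (pderiv ^^ j) ([:-1, 0, 1:] ^ n)"
  obtain Z where Z: "finite Z" "card Z = j" "\<And>z. z \<in> Z \<Longrightarrow> -1 < z \<and> z < 1 \<and> poly R z = 0"
    using Suc by (auto simp: R_def)
  let ?Z = "insert (-1) (insert 1 Z)"
  have "card ?Z = Suc (Suc j)" using Z by (auto simp: card_insert_if)
  moreover have "poly R z = 0" if "z \<in> ?Z" for z
    using that Z Suc.prems poly_funpow_pderiv_rodrigues[of j n z] by (auto simp: R_def)
  ultimately obtain Y where "finite Y" "card Y = Suc j"
      "\<And>y. y \<in> Y \<Longrightarrow> Min ?Z < y \<and> y < Max ?Z \<and> poly (pderiv R) y = 0"
    using rolle_finite_set[of ?Z "Suc j" R] Z(1) by blast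
  moreover have "Min ?Z = -1" "Max ?Z = 1"
    using Z(1,3) by (intro Min_eqI Max_eqI; force simp: less_imp_le)+
  ultimately show ?case by (auto simp: R_def)
qed

text \<open>The case \<open>j = n\<close> of the Rolle argument gives \<open>n\<close> interior
  zeros, and the degree leaves room for no others.\<close>

lemma legendre_poly_roots:
  shows finite_legendre_roots: "finite {x. poly (legendre_poly n) x = 0}"
    and card_legendre_roots: "card {x. poly (legendre_poly n) x = 0} = n"
    and legendre_roots_subset: "{x. poly (legendre_poly n) x = 0} \<subseteq> {-1<..<1}"
proof -
  let ?A = "{x. poly (legendre_poly n) x = 0}"
  show fin: "finite ?A" by (rule poly_roots_finite[OF legendre_poly_nonzero])
  obtain Z where Z: "finite Z" "card Z = n" "Z \<subseteq> ?A" "Z \<subseteq> {-1<..<1}"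
    using funpow_pderiv_rodrigues_roots[of n n] by (auto simp: legendre_poly_def subset_iff)
  have "card ?A \<le> n"
    using card_poly_roots_bound[OF legendre_poly_nonzero] by (simp add: degree_legendre_poly)
  then have "Z = ?A" using Z fin by (intro card_seteq) auto
  then show "card ?A = n" "?A \<subseteq> {-1<..<1}" using Z by auto
qed

lemma bij_betw_gauss_point:
  "bij_betw (gauss_point n) {1..n} {x. poly (legendre_poly n) x = 0}"
proof -
  let ?A = "{x. poly (legendre_poly n) x = 0}"
  have "bij_betw ((!) (sorted_list_of_set ?A)) {..<n} ?A"
    using finite_legendre_roots[of n] by (intro bij_betw_nth) (auto simp: card_legendre_roots)
  \<comment> \<open>Gauss points are numbered from 1, list positions from 0.\<close>
  moreover have "bij_betw (\<lambda>p. p - 1) {1..n} {..<n}"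
    by (rule bij_betwI[of _ _ _ Suc]) auto
  ultimately have "bij_betw ((!) (sorted_list_of_set ?A) \<circ> (\<lambda>p. p - 1)) {1..n} ?A"
    by (rule bij_betw_trans[rotated])
  then show ?thesis by (simp add: gauss_point_def[abs_def] comp_def)
qed

section \<open>Lagrange interpolation, exactness and positivity of Gauss quadrature\<close>

definition lagrange_basis :: "real set \<Rightarrow> real \<Rightarrow> real poly" where
  "lagrange_basis A a = (\<Prod>b\<in>A - {a}. smult (1 / (a - b)) [:- b, 1:])"

lemma poly_lagrange_basis:
  assumes "finite A" "a \<in> A" "x \<in> A"
  shows "poly (lagrange_basis A a) x = (if x = a then 1 else 0)"
  using assms by (auto simp: lagrange_basis_def poly_prod intro!: prod.neutral simp flip: diff_divide_distrib)

lemma degree_lagrange_basis: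
  assumes "finite A" "a \<in> A"
  shows "degree (lagrange_basis A a) < card A"
proof -
  have "degree (lagrange_basis A a) \<le> (\<Sum>b\<in>A - {a}. degree (smult (1 / (a - b)) [:- b, 1:]))"
    unfolding lagrange_basis_def using assms degree_prod_sum_le[of "A - {a}" "\<lambda>b. smult (1 / (a - b)) [:- b, 1:]"]
    by (simp add: comp_def del: smult_pCons)
  also have "\<dots> \<le> (\<Sum>b\<in>A - {a}. 1)"
    by (intro sum_mono) simp
  also have "\<dots> < card A"
    using card_Diff1_less[OF assms] by (simp del: card_Diff_insert)
  finally show ?thesis .
qed

text \<open>Both sides have degree below \<open>card A\<close> and agree at the
  \<open>card A\<close> points of \<open>A\<close>.\<close>

lemma lagrange_interpolation:
  assumes "finite A" "degree q < card A"
  shows "q = (\<Sum>a\<in>A. smult (poly q a) (lagrange_basis A a))"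
proof (rule poly_eqI_degree[of A])
  have "card A > 0" using assms by simp
  then have "degree (\<Sum>a\<in>A. smult (poly q a) (lagrange_basis A a)) \<le> card A - 1"
    using assms(1) degree_lagrange_basis[OF assms(1)]
    by (intro degree_sum_le) (fastforce intro: order_trans[OF degree_smult_le])+
  then show "degree (\<Sum>a\<in>A. smult (poly q a) (lagrange_basis A a)) < card A"
    using \<open>card A > 0\<close> by simp
  show "poly q x = poly (\<Sum>a\<in>A. smult (poly q a) (lagrange_basis A a)) x" if "x \<in> A" for x
    using that assms(1) by (simp add: poly_sum poly_lagrange_basis if_distrib sum.delta cong: if_cong)
qed (use assms in auto)

text \<open>Divide \<open>q\<close> by the Legendre polynomial. The multiple \<open>?P * s\<close>
  integrates to 0 by orthogonality and vanishes at every node, so both sides see only the remainder,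
  which interpolation at the nodes reproduces.\<close>

lemma gauss_quadrature_roots:
  fixes q :: "real poly" and n :: nat
  defines "A \<equiv> {x. poly (legendre_poly n) x = 0}"
  assumes "degree q < 2 * n"
  shows "integral {-1..1} (poly q) = (\<Sum>a\<in>A. integral {-1..1} (poly (lagrange_basis A a)) * poly q a)"
proof -
  let ?P = "legendre_poly n"
  define s r where "s = q div ?P" and "r = q mod ?P"
  have A: "finite A" "card A = n" by (simp_all add: A_def finite_legendre_roots card_legendre_roots)
  have q: "q = ?P * s + r" by (simp add: s_def r_def)
  have "n > 0" using assms by simp
  have r: "degree r < n"
    using degree_mod_less'[OF legendre_poly_nonzero, of q n] \<open>n > 0\<close>
    by (cases "r = 0") (simp_all add: r_def degree_legendre_poly)
  \<comment> \<open>The remainder has degree below \<open>n\<close> and cannot cancel the leading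
    term of \<open>?P * s\<close>, so \<open>n + degree s = degree q < 2 * n\<close>.\<close>
  have s: "degree s < n"
  proof (cases "s = 0")
    case False
    then have Ps: "degree (?P * s) = n + degree s"
      by (simp add: degree_mult_eq legendre_poly_nonzero degree_legendre_poly)
    then have "degree q = n + degree s"
      using r unfolding q by (simp add: degree_add_eq_left)
    then show ?thesis using assms by simp
  qed (use \<open>n > 0\<close> in simp)
  have "integral {-1..1} (poly q) = integral {-1..1} (poly (?P * s)) + integral {-1..1} (poly r)"
    unfolding q by (simp only: poly_add[abs_def] integral_add[OF integrable_poly integrable_poly])
  also have "\<dots> = integral {-1..1} (poly r)"
    by (simp only: integral_legendre_mult[OF s])
  also have "\<dots> = integral {-1..1} (\<lambda>x. \<Sum>a\<in>A. poly (lagrange_basis A a) x * poly r a)"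
    using r A by (subst lagrange_interpolation[of A r]) (simp_all add: poly_sum[abs_def] mult.commute)
  also have "\<dots> = (\<Sum>a\<in>A. integral {-1..1} (poly (lagrange_basis A a)) * poly r a)"
    by (subst integral_sum) (auto intro!: A integrable_on_mult_left integrable_poly)
  also have "\<dots> = (\<Sum>a\<in>A. integral {-1..1} (poly (lagrange_basis A a)) * poly q a)"
    by (rule sum.cong) (simp_all add: q A_def)
  finally show ?thesis .
qed

theorem gauss_quadrature:
  obtains W where "\<And>p. p \<in> {1..n} \<Longrightarrow> 0 \<le> W p"
    and "\<And>q. degree q < 2 * n \<Longrightarrow>
      integral {-1..1} (poly q) = (\<Sum>p=1..n. W p * poly q (gauss_point n p))"
proof
  define A where "A = {x. poly (legendre_poly n) x = 0}"
  define w where "w a = integral {-1..1} (poly (lagrange_basis A a))" for a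
  have A: "finite A" "card A = n" by (simp_all add: A_def finite_legendre_roots card_legendre_roots)
  have bij: "bij_betw (gauss_point n) {1..n} A"
    using bij_betw_gauss_point by (simp add: A_def)
  have exact: "integral {-1..1} (poly q) = (\<Sum>a\<in>A. w a * poly q a)" if "degree q < 2 * n" for q
    unfolding w_def A_def by (rule gauss_quadrature_roots[OF that])
  \<comment> \<open>Exactness applied to the square of the basis polynomial at the node: the degree
    is at most 2(n - 1), and the quadrature sum collapses to the weight, which is thus the integral
    of a square.\<close>
  show "0 \<le> w (gauss_point n p)" if "p \<in> {1..n}" for p
  proof -
    define a where "a = gauss_point n p"
    have a: "a \<in> A" using bij that by (auto simp: a_def bij_betw_def)
    let ?l = "lagrange_basis A a"
    have "degree (?l\<^sup>2) < 2 * n"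
      using degree_lagrange_basis[OF A(1) a] A degree_power_le[of ?l 2] by simp
    then have "integral {-1..1} (poly (?l\<^sup>2)) = (\<Sum>b\<in>A. w b * (if b = a then 1 else 0))"
      using A a by (subst exact) (auto intro!: sum.cong simp: poly_lagrange_basis)
    also have "\<dots> = w a" using A a by (simp add: if_distrib sum.delta cong: if_cong)
    moreover have "0 \<le> integral {-1..1} (poly (?l\<^sup>2))"
      by (rule integral_nonneg[OF integrable_poly]) simp
    ultimately show ?thesis by (simp add: a_def)
  qed
  show "integral {-1..1} (poly q) = (\<Sum>p=1..n. w (gauss_point n p) * poly q (gauss_point n p))"
    if "degree q < 2 * n" for q
    using exact[OF that] sum.reindex_bij_betw[OF bij, of "\<lambda>a. w a * poly q a"] by simp
qed

section \<open>Discontinuous Galerkin spaces\<close>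

lemma mono_edge: "valid_mesh M \<Longrightarrow> mono (edge M)"
  by (auto simp: mono_def edge_def valid_mesh_def intro!: mult_right_mono divide_right_mono)

lemma strict_mono_edge: "valid_mesh M \<Longrightarrow> strict_mono (edge M)"
  by (auto simp: strict_mono_def edge_def valid_mesh_def intro!: mult_strict_right_mono divide_strict_right_mono)

lemma mesh_dom_edge: "valid_mesh M \<Longrightarrow> mesh_dom M = {edge M 0..edge M (mesh_n M)}"
  by (simp add: edge_def valid_mesh_def mesh_dom_def)

lemma cell_subset_mesh_dom:
  assumes "valid_mesh M" "j \<in> {1..mesh_n M}"
  shows "cell M j \<subseteq> mesh_dom M"
  using assms monoD[OF mono_edge[OF assms(1)], of 0 "j - 1"]
    monoD[OF mono_edge[OF assms(1)], of j "mesh_n M"]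
  by (auto simp: mesh_dom_edge cell_def)

lemma interior_cell: "interior (cell M j) = {edge M (j - 1)<..<edge M j}"
  by (simp add: cell_def interior_atLeastAtMost_real)

lemma has_integral_mesh_dom:
  fixes \<phi> :: "real \<Rightarrow> real"
  assumes "valid_mesh M" "\<And>j. j \<in> {1..mesh_n M} \<Longrightarrow> (\<phi> has_integral I j) (cell M j)"
  shows "(\<phi> has_integral (\<Sum>j=1..mesh_n M. I j)) (mesh_dom M)"
  using has_integral_partition[OF mono_edge[OF assms(1)], of "mesh_n M" \<phi> I] assms
  by (simp add: mesh_dom_edge cell_def)

lemma dg_spaceE:
  assumes "g \<in> dg_space M k" "j \<in> {1..mesh_n M}"
  obtains q where "degree q \<le> k" "\<And>x. x \<in> interior (cell M j) \<Longrightarrow> g x = poly q x"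
  using assms unfolding dg_space_def by blast

text \<open>Equality is asked only on the domain because \<open>dg_space2\<close> prescribes values
  only there; this suffices since the cells lie inside it.\<close>

lemma dg_space_sum:
  assumes "\<And>m. m < r \<Longrightarrow> g m \<in> dg_space M k"
    and eq: "\<And>x. x \<in> mesh_dom M \<Longrightarrow> u x = (\<Sum>m<(r::nat). c m * g m x)" and M: "valid_mesh M"
  shows "u \<in> dg_space M k"
  unfolding dg_space_def
proof (intro CollectI ballI)
  fix j assume j: "j \<in> {1..mesh_n M}"
  have "\<forall>m\<in>{..<r}. \<exists>q. degree q \<le> k \<and> (\<forall>x\<in>interior (cell M j). g m x = poly q x)"
    using assms(1) j by (auto simp: dg_space_def)
  then obtain q where q: "\<And>m. m < r \<Longrightarrow> degree (q m) \<le> k"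
      "\<And>m x. m < r \<Longrightarrow> x \<in> interior (cell M j) \<Longrightarrow> g m x = poly (q m) x"
    by (metis (no_types, lifting) bchoice lessThan_iff)
  have "degree (\<Sum>m<r. smult (c m) (q m)) \<le> k"
    by (intro degree_sum_le) (auto intro: order_trans[OF degree_smult_le] q)
  moreover have "u x = poly (\<Sum>m<r. smult (c m) (q m)) x" if "x \<in> interior (cell M j)" for x
    using that eq[of x] q cell_subset_mesh_dom[OF M j] interior_subset[of "cell M j"]
    by (auto simp: poly_sum)
  ultimately show "\<exists>q. degree q \<le> k \<and> (\<forall>x\<in>interior (cell M j). u x = poly q x)" by blast
qed

text \<open>Freezing one variable turns the sum of products into a linear combination of the factors
  in the other variable.\<close>

lemma dg_space2_slice:
  assumes "f \<in> dg_space2 X V k" "valid_mesh X" "valid_mesh V"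
  shows dg_space2_slice_x: "v \<in> mesh_dom V \<Longrightarrow> (\<lambda>x. f x v) \<in> dg_space X k"
    and dg_space2_slice_v: "x \<in> mesh_dom X \<Longrightarrow> f x \<in> dg_space V k"
proof -
  obtain r :: nat and g h where gh: "\<And>m. m < r \<Longrightarrow> g m \<in> dg_space X k"
      "\<And>m. m < r \<Longrightarrow> h m \<in> dg_space V k"
      "\<And>x v. x \<in> mesh_dom X \<Longrightarrow> v \<in> mesh_dom V \<Longrightarrow> f x v = (\<Sum>m<r. g m x * h m v)"
    using assms(1) unfolding dg_space2_def by blast
  show "(\<lambda>x. f x v) \<in> dg_space X k" if "v \<in> mesh_dom V"
    by (rule dg_space_sum[where g = g and r = r and c = "\<lambda>m. h m v"])
      (use gh that assms in \<open>auto simp: mult.commute\<close>)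
  show "f x \<in> dg_space V k" if "x \<in> mesh_dom X"
    by (rule dg_space_sum[where g = h and r = r and c = "\<lambda>m. g m x"]) (use gh that assms in auto)
qed

text \<open>The arbitrary values at the two cell edges form a null set.\<close>

lemma has_integral_poly_on_interior:
  assumes "\<And>x. x \<in> interior (cell M j) \<Longrightarrow> \<phi> x = poly q x"
  shows "(\<phi> has_integral integral (cell M j) (poly q)) (cell M j)"
proof (rule has_integral_spike_finite)
  show "finite {edge M (j - 1), edge M j}" by simp
  show "\<phi> x = poly q x" if "x \<in> cell M j - {edge M (j - 1), edge M j}" for x
    using that assms by (auto simp: interior_cell) (auto simp: cell_def)
  show "(poly q has_integral integral (cell M j) (poly q)) (cell M j)"
    unfolding cell_def by (intro integrable_integral integrable_poly)
qed

lemma dg_space_square_integrable: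
  assumes "valid_mesh M" "g \<in> dg_space M k"
  shows "(\<lambda>x. (g x)\<^sup>2) integrable_on mesh_dom M"
proof -
  have "(\<lambda>x. (g x)\<^sup>2) integrable_on cell M j" if j: "j \<in> {1..mesh_n M}" for j
  proof -
    obtain q where "\<And>x. x \<in> interior (cell M j) \<Longrightarrow> g x = poly q x"
      using dg_spaceE[OF assms(2) j] by blast
    then show ?thesis
      using has_integral_poly_on_interior[of M j "\<lambda>x. (g x)\<^sup>2" "q\<^sup>2"]
      by (intro has_integral_integrable) simp
  qed
  then show ?thesis
    using has_integral_integrable[OF has_integral_mesh_dom[OF assms(1) integrable_integral]] by blast
qed

section \<open>Gauss quadrature for piecewise polynomials and the discrete form of the norm\<close>

lemma gauss_node_interior:
  assumes "valid_mesh M" "i \<in> {1..mesh_n M}" "p \<in> {1..k + 1}"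
  shows "gauss_node M k i p \<in> interior (cell M i)"
proof -
  have "gauss_point (k + 1) p \<in> {-1<..<1}"
    using bij_betwE[OF bij_betw_gauss_point, of "k + 1"] legendre_roots_subset[of "k + 1"] assms(3)
    by blast
  moreover have "edge M (i - 1) < edge M i"
    using strict_mono_edge[OF assms(1)] assms(2) by (simp add: strict_mono_def)
  ultimately have "\<bar>(edge M i - edge M (i - 1)) / 2 * gauss_point (k + 1) p\<bar>
      < (edge M i - edge M (i - 1)) / 2"
    by (simp add: abs_mult abs_less_iff)
  then show ?thesis
    unfolding interior_cell gauss_node_def greaterThanLessThan_iff abs_less_iff
    by (intro conjI; argo)
qed

text \<open>The rule on [-1, 1] is carried to each cell by an affine map; the weights pick up its
  Jacobian, the half-width of the cell.\<close>

lemma gauss_quadrature_dg: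
  assumes "valid_mesh M"
  obtains W where "\<And>i p. i \<in> {1..mesh_n M} \<Longrightarrow> p \<in> {1..k + 1} \<Longrightarrow> 0 \<le> W i p"
    and "\<And>h. h \<in> dg_space M k \<Longrightarrow> integral (mesh_dom M) (\<lambda>v. (h v)\<^sup>2)
      = (\<Sum>i=1..mesh_n M. \<Sum>p=1..k + 1. W i p * (h (gauss_node M k i p))\<^sup>2)"
proof -
  obtain W where W: "\<And>p. p \<in> {1..k + 1} \<Longrightarrow> 0 \<le> W p"
      "\<And>q. degree q < 2 * (k + 1) \<Longrightarrow>
        integral {-1..1} (poly q) = (\<Sum>p=1..k + 1. W p * poly q (gauss_point (k + 1) p))"
    by (fact gauss_quadrature[of "k + 1"])
  define c r where "c i = (edge M (i - 1) + edge M i) / 2"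
    and "r i = (edge M i - edge M (i - 1)) / 2" for i
  have r: "r i > 0" if "i \<in> {1..mesh_n M}" for i
    using strict_mono_edge[OF assms] that by (simp add: strict_mono_def r_def)
  show ?thesis
  proof
    show "0 \<le> r i * W p" if "i \<in> {1..mesh_n M}" "p \<in> {1..k + 1}" for i p
      using r[of i] W(1)[of p] that by simp
    fix h assume h: "h \<in> dg_space M k"
    have "((\<lambda>v. (h v)\<^sup>2) has_integral (\<Sum>p=1..k + 1. r i * W p * (h (gauss_node M k i p))\<^sup>2)) (cell M i)"
      if i: "i \<in> {1..mesh_n M}" for i
    proof -
      obtain q where q: "degree q \<le> k" "\<And>x. x \<in> interior (cell M i) \<Longrightarrow> h x = poly q x"
        using dg_spaceE[OF h i] by blast
      \<comment> \<open>The square pulled back to [-1, 1]; the affine map is not constant, so the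
        degree stays at most \<open>2 * k\<close>.\<close>
      define Q where "Q = (q\<^sup>2) \<circ>\<^sub>p [:c i, r i:]"
      have "degree Q = degree (q\<^sup>2)"
        using r[OF i] by (simp add: Q_def degree_pcompose)
      then have "degree Q < 2 * (k + 1)"
        using degree_power_le[of q 2] q(1) by simp
      then have "integral {-1..1} (poly Q) = (\<Sum>p=1..k + 1. W p * poly Q (gauss_point (k + 1) p))"
        by (rule W(2))
      \<comment> \<open>Here it matters that the nodes are interior to the cell: at an edge
        \<open>h\<close> need not agree with \<open>q\<close>.\<close>
      also have "\<dots> = (\<Sum>p=1..k + 1. W p * (h (gauss_node M k i p))\<^sup>2)"
        using q(2)[OF gauss_node_interior[OF assms i]]
        by (intro sum.cong) (simp_all add: Q_def poly_pcompose gauss_node_def c_def r_def mult.commute)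
      finally have Q: "integral {-1..1} (poly Q) = (\<Sum>p=1..k + 1. W p * (h (gauss_node M k i p))\<^sup>2)" .
      have "(poly (q\<^sup>2) has_integral integral (cell M i) (poly (q\<^sup>2))) {edge M (i - 1)..edge M i}"
        unfolding cell_def by (intro integrable_integral integrable_poly)
      from has_integral_affinity[OF this[folded cbox_interval], of "r i" "c i"]
      have "((\<lambda>x. poly (q\<^sup>2) (r i * x + c i)) has_integral integral (cell M i) (poly (q\<^sup>2)) / r i)
          ((\<lambda>x. x / r i - c i / r i) ` {edge M (i - 1)..edge M i})"
        using r[OF i] by (simp add: divide_inverse mult.commute)
      also have "(\<lambda>x. x / r i - c i / r i) ` {edge M (i - 1)..edge M i} = {-1..1}"
      proof -
        have "edge M (i - 1) = c i - r i" "edge M i = c i + r i"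
          by (simp_all add: c_def r_def field_simps)
        moreover have "edge M (i - 1) \<le> edge M i" using r[OF i] by (simp add: r_def)
        ultimately show ?thesis
          using r[OF i] image_affinity_atLeastAtMost_div_diff[of "r i" "c i / r i" "edge M (i - 1)" "edge M i"]
          by (auto simp: field_simps)
      qed
      finally have "integral {-1..1} (poly Q) = integral (cell M i) (poly (q\<^sup>2)) / r i"
        by (simp add: has_integral_iff Q_def poly_pcompose[abs_def] poly_power[abs_def] algebra_simps)
      then have "integral (cell M i) (poly (q\<^sup>2)) = (\<Sum>p=1..k + 1. r i * W p * (h (gauss_node M k i p))\<^sup>2)"
        using Q r[OF i] by (simp add: field_simps sum_distrib_left)
      moreover have "((\<lambda>v. (h v)\<^sup>2) has_integral integral (cell M i) (poly (q\<^sup>2))) (cell M i)"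
        by (rule has_integral_poly_on_interior) (simp add: q)
      ultimately show ?thesis by simp
    qed
    from has_integral_mesh_dom[OF assms this]
    show "integral (mesh_dom M) (\<lambda>v. (h v)\<^sup>2)
      = (\<Sum>i=1..mesh_n M. \<Sum>p=1..k + 1. r i * W p * (h (gauss_node M k i p))\<^sup>2)"
      by (rule integral_unique)
  qed
qed

text \<open>Quadrature in \<open>v\<close> for each fixed \<open>x\<close>, then the finite sums are
  pulled out of the integral in \<open>x\<close>. The weights are chosen before \<open>f\<close>, so
  the norms of two functions can be compared node by node.\<close>

lemma l2_norm_gauss:
  assumes "valid_mesh X" "valid_mesh V"
  obtains W where "\<And>i p. i \<in> {1..mesh_n V} \<Longrightarrow> p \<in> {1..k + 1} \<Longrightarrow> 0 \<le> W i p"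
    and "\<And>f. f \<in> dg_space2 X V k \<Longrightarrow> l2_norm X V f = sqrt (\<Sum>i=1..mesh_n V. \<Sum>p=1..k + 1.
      W i p * integral (mesh_dom X) (\<lambda>x. (f x (gauss_node V k i p))\<^sup>2))"
proof -
  obtain W where W: "\<And>i p. i \<in> {1..mesh_n V} \<Longrightarrow> p \<in> {1..k + 1} \<Longrightarrow> 0 \<le> W i p"
    "\<And>h. h \<in> dg_space V k \<Longrightarrow> integral (mesh_dom V) (\<lambda>v. (h v)\<^sup>2)
      = (\<Sum>i=1..mesh_n V. \<Sum>p=1..k + 1. W i p * (h (gauss_node V k i p))\<^sup>2)"
    by (fact gauss_quadrature_dg[OF assms(2)])
  show ?thesis
  proof
    fix f assume f: "f \<in> dg_space2 X V k"
    have int: "(\<lambda>x. (f x (gauss_node V k i p))\<^sup>2) integrable_on mesh_dom X"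
      if "i \<in> {1..mesh_n V}" "p \<in> {1..k + 1}" for i p
    proof -
      have "gauss_node V k i p \<in> mesh_dom V"
        using gauss_node_interior[OF assms(2) that] interior_subset cell_subset_mesh_dom[OF assms(2) that(1)]
        by blast
      then show ?thesis
        using dg_space_square_integrable[OF assms(1) dg_space2_slice_x[OF f assms]] by blast
    qed
    have "integral (mesh_dom X) (\<lambda>x. integral (mesh_dom V) (\<lambda>v. \<bar>f x v\<bar>\<^sup>2))
        = integral (mesh_dom X) (\<lambda>x. \<Sum>i=1..mesh_n V. \<Sum>p=1..k + 1. W i p * (f x (gauss_node V k i p))\<^sup>2)"
      using W(2)[OF dg_space2_slice_v[OF f assms]] by (intro integral_cong) simp
    also have "\<dots> = (\<Sum>i=1..mesh_n V. \<Sum>p=1..k + 1.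
        W i p * integral (mesh_dom X) (\<lambda>x. (f x (gauss_node V k i p))\<^sup>2))"
      using int by (subst integral_sum, simp, fastforce intro!: integrable_sum integrable_on_mult_right)
        (intro sum.cong refl, subst integral_sum, auto intro!: integrable_on_mult_right)
    finally show "l2_norm X V f = sqrt (\<Sum>i=1..mesh_n V. \<Sum>p=1..k + 1.
        W i p * integral (mesh_dom X) (\<lambda>x. (f x (gauss_node V k i p))\<^sup>2))"
      by (simp add: l2_norm_def)
  qed (rule W(1))
qed

section \<open>Contraction along one line and the stability estimate\<close>

lemma transport_projection_contracts:
  assumes X: "valid_mesh X" and g: "g \<in> dg_space X k" and g': "g' \<in> dg_space X k"
    and step: "\<And>j. j \<in> {1..mesh_n X} \<Longrightarrow> integral (cell X j) (\<lambda>x. g' x * g' x)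
      = integral {edge X (j - 1) - s..edge X j - s} (\<lambda>x. periodic_ext X g x * g' (x + s))"
  shows "integral (mesh_dom X) (\<lambda>x. (g' x)\<^sup>2) \<le> integral (mesh_dom X) (\<lambda>x. (g x)\<^sup>2)"
proof -
  define G where "G = (\<lambda>x. (periodic_ext X g x)\<^sup>2)"
  let ?S = "\<lambda>j. {edge X (j - 1) - s..edge X j - s}"
  have G: "(G has_integral integral (mesh_dom X) (\<lambda>x. (g x)\<^sup>2)) {edge X 0 - s..edge X (mesh_n X) - s}"
  proof -
    \<comment> \<open>Squaring commutes with periodic extension, so the one-period integral formula
      applies to the square of \<open>g\<close>.\<close>
    have "G = periodic_ext X (\<lambda>x. (g x)\<^sup>2)" by (simp add: G_def periodic_ext_def fun_eq_iff Let_def)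
    then show ?thesis
      using has_integral_periodic_ext[OF X dg_space_square_integrable[OF X g]] X
      by (simp add: edge_def valid_mesh_def)
  qed
  have G_int: "G integrable_on ?S j" if "j \<in> {1..mesh_n X}" for j
    using cell_subset_mesh_dom[OF X that]
      monoD[OF mono_edge[OF X], of 0 "j - 1"] monoD[OF mono_edge[OF X], of j "mesh_n X"] that
    by (intro integrable_on_subinterval[OF has_integral_integrable[OF G]]) auto
  have g'_int: "(\<lambda>x. (g' x)\<^sup>2) integrable_on cell X j" if "j \<in> {1..mesh_n X}" for j
    using integrable_on_subinterval[OF dg_space_square_integrable[OF X g']]
      cell_subset_mesh_dom[OF X that] by (simp add: cell_def)
  \<comment> \<open>Let A be the left side and B the right side. Translation shows that the
    transported test function also has square integral A, so the scheme gives A \<le> (B + A) / 2,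
    that is A \<le> B.\<close>
  have cell_le: "integral (cell X j) (\<lambda>x. (g' x)\<^sup>2) \<le> integral (?S j) G" if j: "j \<in> {1..mesh_n X}" for j
  proof -
    have tr: "((\<lambda>x. (g' (x + s))\<^sup>2) has_integral integral (cell X j) (\<lambda>x. (g' x)\<^sup>2)) (?S j)"
      using g'_int[OF j] by (intro has_integral_translate) (simp add: cell_def integrable_integral)
    have "integral (cell X j) (\<lambda>x. (g' x)\<^sup>2) = integral (?S j) (\<lambda>x. periodic_ext X g x * g' (x + s))"
      using step[OF j] by (simp add: power2_eq_square)
    also have "\<dots> \<le> (integral (?S j) G + integral (?S j) (\<lambda>x. (g' (x + s))\<^sup>2)) / 2"
      unfolding G_def
      by (rule integral_mult_le_half_sum_squares)
        (use G_int[OF j] tr in \<open>auto simp: G_def integrable_on_def\<close>)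
    also have "integral (?S j) (\<lambda>x. (g' (x + s))\<^sup>2) = integral (cell X j) (\<lambda>x. (g' x)\<^sup>2)"
      using tr by (rule integral_unique)
    finally show ?thesis by simp
  qed
  have "((\<lambda>x. (g' x)\<^sup>2) has_integral (\<Sum>j=1..mesh_n X. integral (cell X j) (\<lambda>x. (g' x)\<^sup>2))) (mesh_dom X)"
    by (intro has_integral_mesh_dom X integrable_integral g'_int)
  then have "integral (mesh_dom X) (\<lambda>x. (g' x)\<^sup>2) = (\<Sum>j=1..mesh_n X. integral (cell X j) (\<lambda>x. (g' x)\<^sup>2))"
    by (rule integral_unique)
  also have "\<dots> \<le> (\<Sum>j=1..mesh_n X. integral (?S j) G)"
    by (intro sum_mono cell_le)
  also have "\<dots> = integral (mesh_dom X) (\<lambda>x. (g x)\<^sup>2)"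
  \<comment> \<open>The integral of \<open>G\<close> over the shifted domain is evaluated twice: as
    a sum over shifted cells, and by \<open>G\<close> above as an integral over one full
    period.\<close>
  proof -
    have "mono (\<lambda>j. edge X j - s)"
      using mono_edge[OF X] by (simp add: mono_def)
    then have "(G has_integral (\<Sum>j=1..mesh_n X. integral (?S j) G)) {edge X 0 - s..edge X (mesh_n X) - s}"
      by (rule has_integral_partition) (intro integrable_integral G_int)
    then show ?thesis using G by (rule has_integral_unique)
  qed
  finally show ?thesis .
qed

theorem theorem4p2:
  fixes X V :: mesh and k :: nat and dt :: real
    and f f' :: "real \<Rightarrow> real \<Rightarrow> real"
  assumes "valid_mesh X" and "valid_mesh V"
    and "f \<in> dg_space2 X V k"
    and "0 < dt"
    and "sldg_step X V k dt f f'"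
  shows "l2_norm X V f' \<le> l2_norm X V f"
proof -
  have f': "f' \<in> dg_space2 X V k" using assms(5) by (simp add: sldg_step_def)
  obtain W where W: "\<And>i p. i \<in> {1..mesh_n V} \<Longrightarrow> p \<in> {1..k + 1} \<Longrightarrow> 0 \<le> W i p"
    "\<And>f. f \<in> dg_space2 X V k \<Longrightarrow> l2_norm X V f = sqrt (\<Sum>i=1..mesh_n V. \<Sum>p=1..k + 1.
      W i p * integral (mesh_dom X) (\<lambda>x. (f x (gauss_node V k i p))\<^sup>2))"
    by (fact l2_norm_gauss[OF assms(1,2)])
  have "integral (mesh_dom X) (\<lambda>x. (f' x (gauss_node V k i p))\<^sup>2)
      \<le> integral (mesh_dom X) (\<lambda>x. (f x (gauss_node V k i p))\<^sup>2)"
    if ip: "i \<in> {1..mesh_n V}" "p \<in> {1..k + 1}" for i p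
  proof -
    let ?w = "gauss_node V k i p"
    have w: "?w \<in> mesh_dom V"
      using gauss_node_interior[OF assms(2) ip] interior_subset cell_subset_mesh_dom[OF assms(2) ip(1)]
      by blast
    note slices = dg_space2_slice_x[OF assms(3,1,2) w] dg_space2_slice_x[OF f' assms(1,2) w]
    show ?thesis
    proof (rule transport_projection_contracts[OF assms(1) slices, where s = "?w * dt"])
      \<comment> \<open>The scheme tested with the slice of \<open>f'\<close> itself along the line,
        an admissible test function by the second fact in \<open>slices\<close>.\<close>
      show "integral (cell X j) (\<lambda>x. f' x ?w * f' x ?w)
          = integral {edge X (j - 1) - ?w * dt..edge X j - ?w * dt}
              (\<lambda>x. periodic_ext X (\<lambda>x. f x ?w) x * f' (x + ?w * dt) ?w)"
        if "j \<in> {1..mesh_n X}" for j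
        using assms(5)[unfolded sldg_step_def Let_def, THEN conjunct2, rule_format, OF ip that slices(2)] .
    qed
  qed
  then show ?thesis
    using W(1) by (simp only: W(2)[OF assms(3)] W(2)[OF f'])
      (intro real_sqrt_le_mono sum_mono mult_left_mono)
qed

end
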